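(* Let $(X, \delta\colon X \rightarrow (\mathcal{P}_{\omega} X)^A)$ be an LTS. Then for all $x \in X$, $\bar{w}\in (A \times \mathcal{P}_{\omega}({A}))^{*}$ and $\mathcal{I}\in\{\mathcal{RT},\mathcal{FT}\}$, $[\![ \{x\} ]\!](\bar{w}) = \varphi^{\mathcal{I}}_{x}(\bar{w})$.
   Context: An LTS is a pair $(X,\delta\colon X\to(\mathcal{P}_\omega X)^A)$ ($\mathcal{P}_\omega$ = finite powerset). For $\varphi\colon A\to\mathcal{P}_\omega X$, $I(\varphi)=\{a\mid\varphi(a)\neq\emptyset\}$ and $Fail(\varphi)=\{Z\subseteq A\mid Z\cap I(\varphi)=\emptyset\}$. The transition function is modified to $\overline{\delta}\colon X\to(\mathcal{P}_\omega X)^{A\times\mathcal{P}_\omega(A)}$, $\overline{\delta}(x)(\langle a,Z\rangle)=\delta(x)(a)$ if $Z=I(\delta(x))$ and $\emptyset$ otherwise; write $x\xrightarrow{\bar w}y$ for the transitions of $\overline{\delta}$, extended to words over $A\times\mathcal{P}_\omega(A)$. The states are decorated with $\overline{o}_{\mathcal{RT}}(x)=\{I(\delta(x))\}$ (ready trace) or $\overline{o}_{\mathcal{FT}}(x)=Fail(\delta(x))$ (failure trace), in $B=\mathcal{P}_\omega(\mathcal{P}_\omega A)$. The decorated system is determinised into the Moore automaton $(\mathcal{P}_\omega X,\langle o,t\rangle)$ with input alphabet $A\times\mathcal{P}_\omega(A)$, $o(Y)=\bigcup_{y\in Y}\overline{o}_{\mathcal{I}}(y)$, $t(Y)(\langle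 a,Z\rangle)=\bigcup_{y\in Y}\overline{\delta}(y)(\langle a,Z\rangle)$; $[\![-]\!]$ is the unique map into the final Moore coalgebra, $[\![Y]\!](\varepsilon)=o(Y)$, $[\![Y]\!](\langle a,Z\rangle\bar w)=[\![t(Y)(\langle a,Z\rangle)]\!](\bar w)$. Finally $\varphi^{\mathcal{RT}}_x(\bar w)=\{Z\subseteq A\mid x\xrightarrow{\bar w}y\land Z=I(\delta(y))\}$ and $\varphi^{\mathcal{FT}}_x(\bar w)=\{Z\subseteq A\mid x\xrightarrow{\bar w}y\land Z\in Fail(\delta(y))\}$, encoding the ready traces, resp. failure traces, of $x$. *)

theory Defs
  imports Main "HOL-Library.FSet"
begin

text \<open>
  Labelled transition systems with state set \<open>'x\<close> and label set \<open>'a\<close>; images are finite subsets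
  of \<open>'x\<close>. Decorations are elements of \<open>'a set set\<close>; when \<open>'a\<close> is finite this is the set of
  finite sets of finite subsets of \<open>'a\<close>.
\<close>

type_synonym ('x, 'a) lts = "'x \<Rightarrow> 'a \<Rightarrow> 'x fset"

type_synonym 'a elabel = "'a \<times> 'a fset"

definition initials :: "('a \<Rightarrow> 'x fset) \<Rightarrow> 'a set" where
  "initials \<phi> = {a. \<phi> a \<noteq> {||}}"

definition Fail :: "('a \<Rightarrow> 'x fset) \<Rightarrow> 'a set set" where
  "Fail \<phi> = {Z. Z \<inter> initials \<phi> = {}}"

definition ext_trans :: "('x, 'a) lts \<Rightarrow> 'x \<Rightarrow> 'a elabel \<Rightarrow> 'x fset" where
  "ext_trans \<delta> x = (\<lambda>(a, Z). if fset Z = initials (\<delta> x) then \<delta> x a else {||})"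

inductive ext_steps :: "('x, 'a) lts \<Rightarrow> 'x \<Rightarrow> 'a elabel list \<Rightarrow> 'x \<Rightarrow> bool"
  for \<delta> :: "('x, 'a) lts" where
  Nil: "ext_steps \<delta> x [] x"
| Cons: "z |\<in>| ext_trans \<delta> x l \<Longrightarrow> ext_steps \<delta> z w y \<Longrightarrow> ext_steps \<delta> x (l # w) y"

text \<open>\<open>RT\<close> selects ready traces, \<open>FT\<close> failure traces.\<close>

datatype semantics = RT | FT

fun decoration :: "semantics \<Rightarrow> ('x, 'a) lts \<Rightarrow> 'x \<Rightarrow> 'a set set" where
  "decoration RT \<delta> x = {initials (\<delta> x)}"
| "decoration FT \<delta> x = Fail (\<delta> x)"

fun traces :: "semantics \<Rightarrow> ('x, 'a) lts \<Rightarrow> 'x \<Rightarrow> 'a elabel list \<Rightarrow> 'a set set" where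
  "traces RT \<delta> x w = {Z. \<exists>y. ext_steps \<delta> x w y \<and> Z = initials (\<delta> y)}"
| "traces FT \<delta> x w = {Z. \<exists>y. ext_steps \<delta> x w y \<and> Z \<in> Fail (\<delta> y)}"

record ('s, 'i, 'b) moore =
  out :: "'s \<Rightarrow> 'b"
  next_state :: "'s \<Rightarrow> 'i \<Rightarrow> 's"

definition moore_hom :: "('s, 'i, 'b) moore \<Rightarrow> ('r, 'i, 'b) moore \<Rightarrow> ('s \<Rightarrow> 'r) \<Rightarrow> bool" where
  "moore_hom M N h \<longleftrightarrow>
     (\<forall>s. out N (h s) = out M s) \<and> (\<forall>s i. next_state N (h s) i = h (next_state M s i))"

definition final_moore :: "('i list \<Rightarrow> 'b, 'i, 'b) moore" where
  "final_moore = \<lparr>out = (\<lambda>f. f []), next_state = (\<lambda>f i w. f (i # w))\<rparr>"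

primrec behaviour_aux :: "('s, 'i, 'b) moore \<Rightarrow> 'i list \<Rightarrow> 's \<Rightarrow> 'b" where
  "behaviour_aux M [] s = out M s"
| "behaviour_aux M (i # w) s = behaviour_aux M w (next_state M s i)"

lemma moore_hom_final_iff:
  "moore_hom M final_moore h \<longleftrightarrow> h = (\<lambda>s w. behaviour_aux M w s)"
proof
  assume h: "moore_hom M final_moore h"
  have "h s w = behaviour_aux M w s" for s w
  proof (induction w arbitrary: s)
    case Nil
    then show ?case using h by (simp add: moore_hom_def final_moore_def)
  next
    case (Cons i w)
    have "h s (i # w) = h (next_state M s i) w"
      using h by (simp add: moore_hom_def final_moore_def fun_eq_iff)
    then show ?case using Cons by simp
  qed
  then show "h = (\<lambda>s w. behaviour_aux M w s)" by blast
qed (simp add: moore_hom_def final_moore_def)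

theorem final_moore_final: "\<exists>!h. moore_hom M final_moore h"
  by (simp add: moore_hom_final_iff)

definition behaviour :: "('s, 'i, 'b) moore \<Rightarrow> 's \<Rightarrow> 'i list \<Rightarrow> 'b" where
  "behaviour M = (THE h. moore_hom M final_moore h)"

lemma moore_hom_behaviour: "moore_hom M final_moore (behaviour M)"
  unfolding behaviour_def by (rule theI'[OF final_moore_final])

lemma behaviour_simps [simp]:
  "behaviour M s [] = out M s"
  "behaviour M s (i # w) = behaviour M (next_state M s i) w"
  using moore_hom_behaviour[of M]
  by (simp_all add: moore_hom_def final_moore_def fun_eq_iff)

definition determinisation ::
  "semantics \<Rightarrow> ('x, 'a) lts \<Rightarrow> ('x fset, 'a elabel, 'a set set) moore" where
  "determinisation \<I> \<delta> =
     \<lparr>out = (\<lambda>Y. \<Union>y\<in>fset Y. decoration \<I> \<delta> y),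
      next_state = (\<lambda>Y l. ffUnion ((\<lambda>y. ext_trans \<delta> y l) |`| Y))\<rparr>"

end

theory Submission
  imports Defs
begin

text \<open>After reading \<open>w\<close>, the subset automaton is in the set of all states
  reachable by \<open>w\<close>, and it outputs the union of their decorations. By
  \<open>traces_eq_UN\<close>, both trace semantics are such unions.\<close>

lemma ext_steps_Nil_iff [simp]: "ext_steps \<delta> x [] y \<longleftrightarrow> y = x"
  by (auto elim: ext_steps.cases intro: ext_steps.Nil)

lemma ext_steps_Cons_iff [simp]:
  "ext_steps \<delta> x (l # w) y \<longleftrightarrow> (\<exists>z. z |\<in>| ext_trans \<delta> x l \<and> ext_steps \<delta> z w y)"
  by (auto elim: ext_steps.cases intro: ext_steps.Cons)

lemma traces_eq_UN: "traces \<I> \<delta> x w = (\<Union>y\<in>{y. ext_steps \<delta> x w y}. decoration \<I> \<delta> y)"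
  by (cases \<I>) auto

text \<open>Singletons are not preserved by transitions, so the induction on \<open>w\<close> needs
  an arbitrary finite set \<open>Y\<close>.\<close>

lemma behaviour_determinisation:
  "behaviour (determinisation \<I> \<delta>) Y w = (\<Union>y\<in>fset Y. traces \<I> \<delta> y w)"
proof (induction w arbitrary: Y)
  case Nil
  show ?case by (simp add: determinisation_def traces_eq_UN)
next
  case (Cons l w)
  have "behaviour (determinisation \<I> \<delta>) Y (l # w)
      = (\<Union>z\<in>fset (ffUnion ((\<lambda>y. ext_trans \<delta> y l) |`| Y)). traces \<I> \<delta> z w)"
    \<comment> \<open>The automaton stays folded until the induction hypothesis has been applied at
      the successor of \<open>Y\<close>.\<close>
    by (simp only: behaviour_simps Cons.IH) (simp add: determinisation_def)
  also have "\<dots> = (\<Union>y\<in>fset Y. traces \<I> \<delta> y (l # w))"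
    \<comment> \<open>Both sides collect the decorations of the states reached from \<open>Y\<close>
      by \<open>l\<close> and then \<open>w\<close>.\<close>
    by (auto simp: traces_eq_UN ffUnion.rep_eq)
  finally show ?case .
qed

theorem theorem4p4:
  fixes \<delta> :: "('x, 'a) lts" and x :: 'x and w :: "'a elabel list" and \<I> :: semantics
  shows "behaviour (determinisation \<I> \<delta>) {|x|} w = traces \<I> \<delta> x w"
  by (simp add: behaviour_determinisation)

end
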